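(* Let $n\ge 1$ and $m\ge 1$ be integers and let $p>2n+1$ be a prime. Then the linear combination of modified binomial coefficients $$\sum_{j=0}^{n} (-1)^j\binom{2n+1}{j}\frac{2(n-j)+1}{2n+1}\cdot \binom{(n+1-j)m}{m}_p$$ is divisible by $p^{(2n+1)\nu_p(m)}$.
   Context: For a prime $p$ and a nonnegative integer $A$, the modified factorial is $A!_p=\prod_{1\le k\le A,\ p\nmid k} k$, and for integers $0\le B\le A$ the modified binomial coefficient is $\binom{A}{B}_p=\frac{A!_p}{B!_p\,(A-B)!_p}$ (an integer). $\nu_p(x)$ denotes the $p$-adic valuation of $x$ (the exponent of the largest power of $p$ dividing $x$). The coefficients $\binom{2n+1}{j}\frac{2(n-j)+1}{2n+1}=\binom{2n}{j}-\binom{2n}{j-1}$ are integers.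
   Formalization: Modified binomial coefficients need not be integers (for p=5, that of 20 over 10 is 92378/3), so "divisible" is read as divisibility among rationals with denominator prime to p; it agrees with ordinary divisibility when the sum is an integer. *)

theory Defs
  imports Complex_Main "HOL-Computational_Algebra.Primes"
begin

definition mod_fact :: "nat \<Rightarrow> nat \<Rightarrow> nat" where
  "mod_fact p A = (\<Prod>k | 1 \<le> k \<and> k \<le> A \<and> \<not> p dvd k. k)"

text \<open>The quotient is taken in the rationals: it is always a \<open>p\<close>-adic unit, but it need not be
  an integer (see \<open>mod_binom_not_integer\<close> below). It is meant for \<open>B \<le> A\<close> only.\<close>

definition mod_binom :: "nat \<Rightarrow> nat \<Rightarrow> nat \<Rightarrow> rat" where
  "mod_binom p A B = of_nat (mod_fact p A) / (of_nat (mod_fact p B) * of_nat (mod_fact p (A - B)))"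

text \<open>The localization of the integers at the prime ideal \<open>(p)\<close>, as a subring of the rationals.\<close>

definition p_integers :: "nat \<Rightarrow> rat set" where
  "p_integers p = {of_int a / of_int b | a b. \<not> int p dvd b}"

text \<open>Divisibility in that subring. On integers it agrees with ordinary divisibility by powers
  of \<open>p\<close> (see \<open>p_dvd_of_int_iff\<close>).\<close>

definition p_dvd :: "nat \<Rightarrow> rat \<Rightarrow> rat \<Rightarrow> bool" where
  "p_dvd p d x \<longleftrightarrow> (\<exists>c \<in> p_integers p. x = d * c)"

lemma p_dvd_of_int_iff:
  assumes "prime p"
  shows "p_dvd p (of_nat (p ^ k)) (of_int x) \<longleftrightarrow> int (p ^ k) dvd x"
proof
  assume "p_dvd p (of_nat (p ^ k)) (of_int x)"
  then obtain a b where b: "\<not> int p dvd b"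
    and eq: "(of_int x :: rat) = of_nat (p ^ k) * (of_int a / of_int b)"
    unfolding p_dvd_def p_integers_def by blast
  have "b \<noteq> 0" using b by auto
  with eq have "(of_int (x * b) :: rat) = of_int (int (p ^ k) * a)"
    by (simp add: field_simps)
  then have "x * b = int (p ^ k) * a" by (simp only: of_int_eq_iff)
  then have "int (p ^ k) dvd x * b" by simp
  moreover have "coprime (int (p ^ k)) b"
    using assms b by (simp add: prime_imp_coprime)
  ultimately show "int (p ^ k) dvd x" by (simp add: coprime_dvd_mult_left_iff)
next
  assume "int (p ^ k) dvd x"
  then obtain y where "x = int (p ^ k) * y" by (auto elim: dvdE)
  moreover have "(of_int y :: rat) \<in> p_integers p"
    unfolding p_integers_def mem_Collect_eq
    using assms by (intro exI[of _ y] exI[of _ 1]) (simp add: prime_nat_iff)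
  ultimately show "p_dvd p (of_nat (p ^ k)) (of_int x)"
    unfolding p_dvd_def by (intro bexI[of _ "of_int y"]) simp_all
qed

lemma mod_fact_0: "mod_fact p 0 = 1"
proof -
  have "{k. 1 \<le> k \<and> k \<le> 0 \<and> \<not> p dvd k} = {}" by auto
  then show ?thesis by (simp only: mod_fact_def prod.empty)
qed

lemma mod_fact_Suc:
  "mod_fact p (Suc A) = (if p dvd Suc A then mod_fact p A else Suc A * mod_fact p A)"
proof -
  have "{k. 1 \<le> k \<and> k \<le> Suc A \<and> \<not> p dvd k} =
    (if p dvd Suc A then {k. 1 \<le> k \<and> k \<le> A \<and> \<not> p dvd k}
     else insert (Suc A) {k. 1 \<le> k \<and> k \<le> A \<and> \<not> p dvd k})"
    by (auto simp: le_Suc_eq)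
  then show ?thesis by (simp add: mod_fact_def)
qed

lemma mod_fact_numeral:
  "mod_fact p (numeral A) = (if p dvd numeral A then mod_fact p (pred_numeral A)
     else numeral A * mod_fact p (pred_numeral A))"
  using mod_fact_Suc[of p "pred_numeral A"] by (simp add: numeral_eq_Suc)

lemma mod_binom_not_integer: "mod_binom 5 20 10 \<notin> \<int>"
proof
  have "mod_binom 5 20 10 = 92378 / 3"
    by (simp add: mod_binom_def mod_fact_numeral mod_fact_0 mod_fact_Suc)
  moreover assume "mod_binom 5 20 10 \<in> \<int>"
  ultimately obtain z :: int where "(92378 / 3 :: rat) = of_int z" by (auto elim: Ints_cases)
  then have "(of_int 92378 :: rat) = of_int (3 * z)" by (simp add: field_simps)
  then have "92378 = 3 * z" by (simp only: of_int_eq_iff)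
  then show False by presburger
qed

end

theory Submission
  imports Defs "HOL-Computational_Algebra.Polynomial" "HOL-Number_Theory.Residue_Primitive_Roots"
begin

text \<open>
  If \<open>p\<close> does not divide \<open>m\<close>, only \<open>p\<close>-integrality is claimed. Otherwise let \<open>Q(x)\<close> be the product of
  \<open>x + i\<close> over all \<open>i \<le> m\<close> prime to \<open>p\<close>, so that the modified binomial coefficient of \<open>(t + 1) m\<close>
  over \<open>m\<close> is \<open>Q(t m) / Q(0)\<close>. The substitution \<open>i \<mapsto> m - i\<close> shows that \<open>Q(t m)\<close> is invariant under
  \<open>t \<mapsto> - 1 - t\<close>, which makes the sum, up to a \<open>p\<close>-adic unit, the full \<open>(2 n + 1)\<close>-st finite
  difference of \<open>(2 t + 1) Q(t m)\<close>. That difference kills all powers of \<open>t\<close> below \<open>2 n + 1\<close>. The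
  surviving terms carry \<open>m ^ (2 n + 1)\<close>, except for one that carries \<open>m ^ (2 n)\<close> times the
  coefficient of \<open>x ^ (2 n)\<close> in \<open>Q\<close>. This coefficient is divisible by the \<open>p\<close>-part of \<open>m\<close>: multiplying
  the roots by some \<open>g\<close> prime to \<open>m\<close> permutes them modulo \<open>m\<close>, and \<open>g\<close> can be chosen as a primitive
  root modulo \<open>p\<close>, where \<open>2 n < p - 1\<close>.
\<close>

subsection \<open>Backward differences\<close>

definition backward_difference :: "nat \<Rightarrow> ('a::ring_1 \<Rightarrow> 'b::ring_1) \<Rightarrow> 'a \<Rightarrow> 'b" where
  "backward_difference N f x = (\<Sum>j\<le>N. (- 1) ^ j * of_nat (N choose j) * f (x - of_nat j))"

lemma backward_difference_linear_combination:
  fixes f :: "'i \<Rightarrow> 'a::ring_1 \<Rightarrow> 'b::comm_ring_1"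
  shows "backward_difference N (\<lambda>y. \<Sum>i\<in>I. c i * f i y) x =
    (\<Sum>i\<in>I. c i * backward_difference N (f i) x)"
  unfolding backward_difference_def sum_distrib_left
  by (subst sum.swap) (simp only: mult_ac)

lemma backward_difference_ident_mult:
  fixes f :: "'a::comm_ring_1 \<Rightarrow> 'a"
  shows "backward_difference (Suc N) (\<lambda>y. y * f y) x =
    x * backward_difference (Suc N) f x + of_nat (Suc N) * backward_difference N f (x - 1)"
proof -
  have "backward_difference (Suc N) (\<lambda>y. y * f y) x = x * backward_difference (Suc N) f x
      - (\<Sum>j\<le>Suc N. (- 1) ^ j * of_nat (j * (Suc N choose j)) * f (x - of_nat j))"
    unfolding backward_difference_def sum_distrib_left sum_subtractf[symmetric]
    by (intro sum.cong refl) (simp add: algebra_simps)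
  also have "(\<Sum>j\<le>Suc N. (- 1) ^ j * of_nat (j * (Suc N choose j)) * f (x - of_nat j)) =
      (\<Sum>j\<le>N. (- 1) ^ Suc j * of_nat (Suc j * (Suc N choose Suc j)) * f (x - of_nat (Suc j)))"
    by (subst sum.atMost_Suc_shift) simp
  also have "\<dots> = - (of_nat (Suc N) * backward_difference N f (x - 1))"
    unfolding backward_difference_def sum_distrib_left sum_negf[symmetric] Suc_times_binomial of_nat_mult
    by (intro sum.cong refl) (simp add: mult_ac diff_diff_eq)
  finally show ?thesis by simp
qed

lemma backward_difference_power_eq_0:
  fixes x :: "'a::comm_ring_1"
  assumes "k < N"
  shows "backward_difference N (\<lambda>y. y ^ k) x = 0"
  using assms
proof (induction k arbitrary: N x)
  case 0
  then show ?case using choose_alternating_sum[of N] by (simp add: backward_difference_def)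
next
  case (Suc k)
  then obtain M where "N = Suc M" "k < M" by (cases N) auto
  then show ?case
    using Suc.IH[of M] Suc.IH[of "Suc M"] by (simp add: backward_difference_ident_mult)
qed

lemma dvd_backward_difference_poly:
  fixes q :: "'a::comm_ring_1 poly"
  assumes "\<And>k. N \<le> k \<Longrightarrow> d dvd Polynomial.coeff q k"
  shows "d dvd backward_difference N (poly q) x"
proof -
  have "backward_difference N (poly q) x =
      (\<Sum>k\<le>Polynomial.degree q. Polynomial.coeff q k * backward_difference N (\<lambda>y. y ^ k) x)"
    unfolding poly_altdef[abs_def] by (rule backward_difference_linear_combination)
  also have "d dvd \<dots>"
  proof (rule dvd_sum)
    fix k
    show "d dvd Polynomial.coeff q k * backward_difference N (\<lambda>y. y ^ k) x"
      using assms[of k] backward_difference_power_eq_0[of k N x] by (cases "k < N") auto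
  qed
  finally show ?thesis .
qed

lemma sum_atMost_odd_symmetric:
  fixes f :: "nat \<Rightarrow> 'a::comm_semiring_1"
  assumes "\<And>j. j \<le> n \<Longrightarrow> f (2 * n + 1 - j) = f j"
  shows "(\<Sum>j\<le>2 * n + 1. f j) = 2 * (\<Sum>j\<le>n. f j)"
proof -
  have "(\<Sum>j\<le>2 * n + 1. f j) = (\<Sum>j\<le>n. f j) + (\<Sum>j=Suc n..2 * n + 1. f j)"
    using sum_up_index_split[of f n "Suc n"] by (simp add: mult_2)
  also have "(\<Sum>j=Suc n..2 * n + 1. f j) = (\<Sum>j\<le>n. f j)"
    by (rule sum.reindex_bij_witness[where i = "\<lambda>j. 2 * n + 1 - j" and j = "\<lambda>j. 2 * n + 1 - j"])
       (use assms in \<open>auto simp flip: assms\<close>)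
  finally show ?thesis by (simp add: mult_2)
qed

lemma backward_difference_skew:
  fixes f :: "'a::ring_1 \<Rightarrow> 'b::comm_ring_1"
  assumes "\<And>y. f (- 1 - y) = - f y"
  shows "backward_difference (2 * n + 1) f (of_nat n) =
    2 * (\<Sum>j\<le>n. (- 1) ^ j * of_nat ((2 * n + 1) choose j) * f (of_nat n - of_nat j))"
  unfolding backward_difference_def
proof (rule sum_atMost_odd_symmetric)
  fix j assume "j \<le> n"
  then have "(of_nat n - of_nat (2 * n + 1 - j) :: 'a) = - 1 - (of_nat n - of_nat j)"
    by (simp add: of_nat_diff mult_2)
  then have "f (of_nat n - of_nat (2 * n + 1 - j)) = - f (of_nat n - of_nat j)"
    by (simp only: assms)
  moreover have "(2 * n + 1) choose (2 * n + 1 - j) = (2 * n + 1) choose j"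
    using \<open>j \<le> n\<close> binomial_symmetric[of j "2 * n + 1"] by simp
  moreover have "(- 1 :: 'b) ^ (2 * n + 1 - j) = - ((- 1) ^ j)"
    using \<open>j \<le> n\<close> by (auto simp: minus_one_power_iff)
  ultimately show "(- 1) ^ (2 * n + 1 - j) * of_nat ((2 * n + 1) choose (2 * n + 1 - j))
      * f (of_nat n - of_nat (2 * n + 1 - j)) =
      (- 1) ^ j * of_nat ((2 * n + 1) choose j) * f (of_nat n - of_nat j)"
    by (simp only: mult_minus_left mult_minus_right minus_minus)
qed

subsection \<open>Nonmultiples of \<open>p\<close>\<close>

definition nonmultiples :: "nat \<Rightarrow> nat \<Rightarrow> nat set" where
  "nonmultiples p m = {k. 1 \<le> k \<and> k \<le> m \<and> \<not> p dvd k}"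

lemma finite_nonmultiples [simp]: "finite (nonmultiples p m)"
  by (simp add: nonmultiples_def)

lemma nonmultiples_less: "p dvd m \<Longrightarrow> i \<in> nonmultiples p m \<Longrightarrow> i < m"
  by (cases "i = m") (auto simp: nonmultiples_def)

lemma nonmultiples_add:
  assumes "p dvd c"
  shows "nonmultiples p (c + m) = nonmultiples p c \<union> (+) c ` nonmultiples p m"
proof (intro equalityI subsetI)
  fix k assume k: "k \<in> nonmultiples p (c + m)"
  show "k \<in> nonmultiples p c \<union> (+) c ` nonmultiples p m"
  proof (cases "k \<le> c")
    case False
    then have "k = c + (k - c)" "k - c \<in> nonmultiples p m"
      using k assms by (auto simp: nonmultiples_def dest: dvd_diffD)
    then show ?thesis by blast
  qed (use k in \<open>auto simp: nonmultiples_def\<close>)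
qed (use assms in \<open>auto simp: nonmultiples_def dvd_add_right_iff\<close>)

lemma nonmultiples_disjoint_shift: "nonmultiples p c \<inter> (+) c ` nonmultiples p m = {}"
  by (auto simp: nonmultiples_def)

lemma card_nonmultiples_mult:
  assumes "p > 0"
  shows "card (nonmultiples p (q * p)) = q * (p - 1)"
proof (induction q)
  case 0
  then show ?case by (simp add: nonmultiples_def)
next
  case (Suc q)
  have "nonmultiples p p = {1..<p}"
    using assms by (auto simp: nonmultiples_def le_less dest: dvd_imp_le)
  then have "card (nonmultiples p p) = p - 1" by simp
  then have "card (nonmultiples p (q * p + p)) = q * (p - 1) + (p - 1)"
    using Suc by (simp add: nonmultiples_add card_Un_disjoint nonmultiples_disjoint_shift card_image)
  then show ?case by (simp add: add.commute)
qed

lemma card_nonmultiples: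
  assumes "p dvd m" "p > 0"
  shows "card (nonmultiples p m) = m div p * (p - 1)"
  using assms card_nonmultiples_mult[of p "m div p"] by simp

lemma bij_betw_diff_nonmultiples:
  assumes "p dvd m"
  shows "bij_betw (\<lambda>i. m - i) (nonmultiples p m) (nonmultiples p m)"
proof -
  have "m - i \<in> nonmultiples p m" if "i \<in> nonmultiples p m" for i
    using that assms nonmultiples_less[OF assms that] dvd_diffD1[of p m i]
    by (auto simp: nonmultiples_def)
  then show ?thesis
    by (intro bij_betwI[where g = "\<lambda>i. m - i"]) (auto simp: nonmultiples_def)
qed

lemma bij_betw_mult_mod_nonmultiples:
  assumes "p dvd m" "coprime g m" "m > 0"
  shows "bij_betw (\<lambda>i. (g * i) mod m) (nonmultiples p m) (nonmultiples p m)"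
proof -
  have "coprime p g"
    using assms by (metis coprime_commute coprime_divisors dvd_refl)
  then have dvd_mult_mod_iff: "p dvd (g * i) mod m \<longleftrightarrow> p dvd i" for i
    using assms(1) by (simp add: dvd_mod_iff coprime_dvd_mult_right_iff)
  have "inj_on (\<lambda>i. (g * i) mod m) (nonmultiples p m)"
  proof (rule inj_onI)
    fix i j
    assume mem: "i \<in> nonmultiples p m" "j \<in> nonmultiples p m"
      and "(g * i) mod m = (g * j) mod m"
    then have "[g * i = g * j] (mod m)" by (simp add: cong_def)
    then have "[i = j] (mod m)" using assms(2) by (simp add: cong_mult_lcancel_nat)
    then show "i = j" using nonmultiples_less[OF assms(1)] mem by (simp add: cong_def)
  qed
  moreover have "(\<lambda>i. (g * i) mod m) ` nonmultiples p m \<subseteq> nonmultiples p m"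
  proof (rule image_subsetI)
    fix i assume "i \<in> nonmultiples p m"
    then have "\<not> p dvd (g * i) mod m" by (simp add: dvd_mult_mod_iff nonmultiples_def)
    moreover from this have "(g * i) mod m \<noteq> 0" by (metis dvd_0_right)
    moreover have "(g * i) mod m \<le> m" using assms(3) by (simp add: less_imp_le)
    ultimately show "(g * i) mod m \<in> nonmultiples p m" by (simp add: nonmultiples_def)
  qed
  ultimately show ?thesis
    unfolding bij_betw_def using endo_inj_surj[OF finite_nonmultiples] by blast
qed

lemma mod_fact_eq_prod_nonmultiples: "mod_fact p m = \<Prod>(nonmultiples p m)"
  by (simp add: mod_fact_def nonmultiples_def)

lemma mod_fact_add:
  assumes "p dvd c"
  shows "mod_fact p (c + m) = mod_fact p c * (\<Prod>i\<in>nonmultiples p m. c + i)"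
  using assms by (simp add: mod_fact_eq_prod_nonmultiples nonmultiples_add prod.union_disjoint
      nonmultiples_disjoint_shift prod.reindex)

lemma mod_fact_pos: "mod_fact p m > 0"
  unfolding mod_fact_eq_prod_nonmultiples by (rule prod_pos) (auto simp: nonmultiples_def)

lemma not_dvd_mod_fact: "prime p \<Longrightarrow> \<not> p dvd mod_fact p m"
  by (auto simp: mod_fact_eq_prod_nonmultiples prime_dvd_prod_iff nonmultiples_def)

subsection \<open>The polynomial with the negated nonmultiples as roots\<close>

definition nonmultiples_poly :: "nat \<Rightarrow> nat \<Rightarrow> int poly" where
  "nonmultiples_poly p m = (\<Prod>i\<in>nonmultiples p m. [:int i, 1:])"

lemma poly_nonmultiples_poly: "poly (nonmultiples_poly p m) x = (\<Prod>i\<in>nonmultiples p m. int i + x)"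
  by (simp add: nonmultiples_poly_def poly_prod)

lemma poly_nonmultiples_poly_reflect:
  assumes "p dvd m" "odd p"
  shows "poly (nonmultiples_poly p m) (- x - int m) = poly (nonmultiples_poly p m) x"
proof -
  have "poly (nonmultiples_poly p m) (- x - int m) =
      (\<Prod>i\<in>nonmultiples p m. (- 1) * (int (m - i) + x))"
    unfolding poly_nonmultiples_poly
    by (intro prod.cong refl) (auto simp: nonmultiples_def of_nat_diff)
  also have "\<dots> = (- 1) ^ card (nonmultiples p m) * (\<Prod>i\<in>nonmultiples p m. int (m - i) + x)"
    by (simp only: prod.distrib prod_constant)
  also have "(- 1 :: int) ^ card (nonmultiples p m) = 1"
    using assms card_nonmultiples[of p m] by (simp add: odd_pos)
  also have "(\<Prod>i\<in>nonmultiples p m. int (m - i) + x) = (\<Prod>i\<in>nonmultiples p m. int i + x)"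
    by (rule prod.reindex_bij_betw[OF bij_betw_diff_nonmultiples[OF assms(1)]])
  finally show ?thesis by (simp add: poly_nonmultiples_poly)
qed

lemma mod_binom_eq_poly_nonmultiples_poly:
  assumes "p dvd m"
  shows "mod_binom p ((t + 1) * m) m =
    of_int (poly (nonmultiples_poly p m) (int t * int m)) / of_nat (mod_fact p m)"
proof -
  have "mod_fact p ((t + 1) * m) = mod_fact p (t * m) * (\<Prod>i\<in>nonmultiples p m. t * m + i)"
    using mod_fact_add[of p "t * m" m] assms by (simp add: add.commute)
  moreover have "poly (nonmultiples_poly p m) (int t * int m) = int (\<Prod>i\<in>nonmultiples p m. t * m + i)"
    by (simp add: poly_nonmultiples_poly add.commute)
  moreover have "(t + 1) * m - m = t * m" by simp
  ultimately show ?thesis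
    unfolding mod_binom_def using mod_fact_pos[of p "t * m"] by (simp add: field_simps)
qed

lemma dvd_prod_diff_prod:
  fixes f g :: "'b \<Rightarrow> 'a::comm_ring_1"
  assumes "\<And>i. i \<in> A \<Longrightarrow> d dvd f i - g i"
  shows "d dvd prod f A - prod g A"
  using assms
proof (induction A rule: infinite_finite_induct)
  case (insert x A)
  have "prod f (insert x A) - prod g (insert x A) =
      (f x - g x) * prod f A + g x * (prod f A - prod g A)"
    using insert.hyps by (simp add: algebra_simps)
  then show ?case using insert by (simp add: dvd_add)
qed simp_all

lemma dvd_power_diff_mult_coeff_nonmultiples_poly:
  assumes "p dvd m" "coprime g m" "m > 0"
  shows "int m dvd (int g ^ k - int g ^ card (nonmultiples p m))
    * Polynomial.coeff (nonmultiples_poly p m) k"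
proof -
  let ?U = "nonmultiples p m" and ?Q = "nonmultiples_poly p m"
  have "pcompose ?Q [:0, int g:] = (\<Prod>i\<in>?U. [:int i, int g:])"
    by (simp add: nonmultiples_poly_def pcompose_prod pcompose_pCons)
  also have "\<dots> = (\<Prod>i\<in>?U. [:int ((g * i) mod m), int g:])"
    by (rule prod.reindex_bij_betw[OF bij_betw_mult_mod_nonmultiples[OF assms], symmetric])
  finally have compose: "pcompose ?Q [:0, int g:] = (\<Prod>i\<in>?U. [:int ((g * i) mod m), int g:])" .
  have smult: "Polynomial.smult (int g ^ card ?U) ?Q = (\<Prod>i\<in>?U. [:int (g * i), int g:])"
    using prod_smult[of "\<lambda>_. int g" "\<lambda>i. [:int i, 1:]" ?U] by (simp add: nonmultiples_poly_def)
  have "[:int m:] dvd pcompose ?Q [:0, int g:] - Polynomial.smult (int g ^ card ?U) ?Q"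
    unfolding compose smult
  proof (rule dvd_prod_diff_prod)
    fix i
    have "int m dvd int ((g * i) mod m) - int (g * i)"
      by (simp add: zmod_int mod_eq_dvd_iff[symmetric])
    then show "[:int m:] dvd [:int ((g * i) mod m), int g:] - [:int (g * i), int g:]"
      by (auto simp: const_poly_dvd_iff coeff_pCons split: nat.split)
  qed
  then have "int m dvd
      Polynomial.coeff (pcompose ?Q [:0, int g:] - Polynomial.smult (int g ^ card ?U) ?Q) k"
    unfolding const_poly_dvd_iff by blast
  then show ?thesis by (simp add: coeff_pcompose_linear algebra_simps)
qed

lemma exists_cong_coprime_nat:
  fixes a m n :: nat
  assumes "coprime a n" "m > 0"
  obtains b where "[b = a] (mod n)" "coprime b m"
proof
  let ?t = "\<Prod>{q \<in> prime_factors m. \<not> q dvd a}"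
  show "[a + n * ?t = a] (mod n)" by (simp add: cong_def)
  show "coprime (a + n * ?t) m"
  proof (rule ccontr)
    assume "\<not> coprime (a + n * ?t) m"
    then obtain q where "prime q" "q dvd a + n * ?t" "q dvd m"
      using prime_factor_nat[of "gcd (a + n * ?t) m"] by (auto simp: coprime_iff_gcd_eq_1)
    have "q \<in> prime_factors m"
      using \<open>prime q\<close> \<open>q dvd m\<close> assms(2) by (simp add: in_prime_factors_iff)
    then have dvd_t_iff: "q dvd ?t \<longleftrightarrow> \<not> q dvd a"
      using \<open>prime q\<close> primes_dvd_imp_eq[OF \<open>prime q\<close>]
      by (auto simp: prime_dvd_prod_iff in_prime_factors_iff)
    show False
    proof (cases "q dvd a")
      case True
      then have "q dvd n * ?t" using \<open>q dvd a + n * ?t\<close> by (simp add: dvd_add_right_iff)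
      then have "q dvd n" using \<open>prime q\<close> True dvd_t_iff by (simp add: prime_dvd_mult_iff)
      then show False
        using True assms(1) \<open>prime q\<close> by (meson coprime_common_divisor not_prime_unit)
    next
      case False
      then have "q dvd n * ?t" using dvd_t_iff by simp
      then show False using False \<open>q dvd a + n * ?t\<close> by (simp add: dvd_add_left_iff)
    qed
  qed
qed

lemma exists_coprime_power_not_cong_1:
  assumes "prime p" "m > 0" "0 < k" "k < p - 1"
  obtains g where "coprime g m" "[g ^ k \<noteq> 1] (mod p)"
proof -
  obtain r where "residue_primroot p r"
    using prime_primitive_root_exists[of p] assms(1) prime_gt_1_nat by auto
  then have "coprime r p" "ord p r = p - 1"
    using assms(1) by (auto simp: residue_primroot_def totient_prime coprime_commute)
  obtain g where g: "[g = r] (mod p)" "coprime g m"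
    using exists_cong_coprime_nat[OF \<open>coprime r p\<close> \<open>m > 0\<close>] .
  have "\<not> p - 1 dvd k" using assms(3,4) by (simp add: nat_dvd_not_less)
  then have "[r ^ k \<noteq> 1] (mod p)" using \<open>ord p r = p - 1\<close> by (metis ord_divides)
  then have "[g ^ k \<noteq> 1] (mod p)" using g(1) by (meson cong_pow cong_sym cong_trans)
  then show ?thesis using that g(2) by blast
qed

lemma power_card_nonmultiples_cong_1:
  assumes "prime p" "p dvd m" "coprime g p"
  shows "[g ^ card (nonmultiples p m) = 1] (mod p)"
proof -
  have "[g ^ (p - 1) = 1] (mod p)"
    using fermat_theorem[OF assms(1), of g] assms(1,3)
    by (metis coprime_absorb_right not_prime_unit)
  then have "[(g ^ (p - 1)) ^ (m div p) = 1 ^ (m div p)] (mod p)" by (rule cong_pow)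
  then show ?thesis
    using card_nonmultiples[OF assms(2)] assms(1)
    by (simp add: power_mult[symmetric] mult.commute prime_gt_0_nat)
qed

lemma prime_power_dvd_coeff_nonmultiples_poly:
  assumes "prime p" "p dvd m" "m > 0" "0 < k" "k < p - 1"
  shows "int (p ^ multiplicity p m) dvd Polynomial.coeff (nonmultiples_poly p m) k"
proof -
  let ?c = "card (nonmultiples p m)"
  obtain g where g: "coprime g m" "[g ^ k \<noteq> 1] (mod p)"
    using exists_coprime_power_not_cong_1[OF assms(1,3-5)] .
  have "coprime g p" using g(1) assms(2) by (metis coprime_divisors dvd_refl)
  then have "[g ^ ?c = 1] (mod p)" using power_card_nonmultiples_cong_1 assms(1,2) by blast
  then have "[g ^ k \<noteq> g ^ ?c] (mod p)" using g(2) cong_trans by blast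
  then have "\<not> int p dvd int g ^ k - int g ^ ?c"
    by (simp add: cong_iff_dvd_diff[symmetric] cong_int_iff flip: of_nat_power)
  then have "coprime (int (p ^ multiplicity p m)) (int g ^ k - int g ^ ?c)"
    using assms(1) by (simp add: prime_imp_coprime)
  moreover have "int (p ^ multiplicity p m) dvd int m"
    unfolding int_dvd_int_iff by (rule multiplicity_dvd)
  then have "int (p ^ multiplicity p m) dvd (int g ^ k - int g ^ ?c)
      * Polynomial.coeff (nonmultiples_poly p m) k"
    using dvd_power_diff_mult_coeff_nonmultiples_poly[OF assms(2) g(1) assms(3)] by (rule dvd_trans)
  ultimately show ?thesis by (simp add: coprime_dvd_mult_right_iff)
qed

definition skew_nonmultiples_poly :: "nat \<Rightarrow> nat \<Rightarrow> int poly" where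
  "skew_nonmultiples_poly p m = [:1, 2:] * pcompose (nonmultiples_poly p m) [:0, int m:]"

lemma poly_skew_nonmultiples_poly:
  "poly (skew_nonmultiples_poly p m) t = (2 * t + 1) * poly (nonmultiples_poly p m) (t * int m)"
  by (simp add: skew_nonmultiples_poly_def poly_pcompose algebra_simps)

lemma poly_skew_nonmultiples_poly_reflect:
  assumes "p dvd m" "odd p"
  shows "poly (skew_nonmultiples_poly p m) (- 1 - t) = - poly (skew_nonmultiples_poly p m) t"
proof -
  have "(- 1 - t) * int m = - (t * int m) - int m" by (simp add: algebra_simps)
  moreover have "2 * (- 1 - t) + 1 = - (2 * t + 1)" by simp
  ultimately show ?thesis
    unfolding poly_skew_nonmultiples_poly
    by (simp only: poly_nonmultiples_poly_reflect[OF assms] mult_minus_left)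
qed

lemma power_dvd_coeff_linear_mult_pcompose:
  fixes q :: "'a::comm_ring_1 poly"
  assumes "d dvd c" "d dvd Polynomial.coeff q k" "k < r"
  shows "d ^ Suc k dvd Polynomial.coeff ([:b, a:] * pcompose q [:0, c:]) r"
proof -
  obtain s where r_eq: "r = Suc s" using assms(3) by (cases r) auto
  have power_dvd: "d ^ Suc k dvd c ^ i" if "k < i" for i
    using assms(1) that by (metis Suc_leI dvd_power_le)
  have "d ^ Suc k dvd c ^ s * Polynomial.coeff q s"
  proof (cases "s = k")
    case True
    then show ?thesis using assms(1,2) by (simp add: mult_dvd_mono dvd_power_same mult.commute)
  next
    case False
    then show ?thesis using power_dvd[of s] assms(3) r_eq by simp
  qed
  moreover have "d ^ Suc k dvd c ^ r * Polynomial.coeff q r"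
    using power_dvd[OF assms(3)] by simp
  ultimately have "d ^ Suc k dvd a * (c ^ s * Polynomial.coeff q s) + b * (c ^ r * Polynomial.coeff q r)"
    by (rule dvd_add[OF dvd_mult dvd_mult])
  then show ?thesis by (simp add: r_eq coeff_pcompose_linear add.commute)
qed

lemma prime_power_dvd_backward_difference_skew_nonmultiples_poly:
  assumes "prime p" "p dvd m" "m > 0" "0 < k" "k < p - 1"
  shows "int (p ^ (Suc k * multiplicity p m)) dvd
    backward_difference (Suc k) (poly (skew_nonmultiples_poly p m)) x"
proof (rule dvd_backward_difference_poly)
  fix r assume "Suc k \<le> r"
  have "int (p ^ multiplicity p m) dvd int m"
    unfolding int_dvd_int_iff by (rule multiplicity_dvd)
  from power_dvd_coeff_linear_mult_pcompose[OF this prime_power_dvd_coeff_nonmultiples_poly[OF assms]]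
  have "int (p ^ multiplicity p m) ^ Suc k dvd Polynomial.coeff (skew_nonmultiples_poly p m) r"
    using \<open>Suc k \<le> r\<close> by (simp only: skew_nonmultiples_poly_def Suc_le_eq)
  then show "int (p ^ (Suc k * multiplicity p m)) dvd Polynomial.coeff (skew_nonmultiples_poly p m) r"
    by (simp only: of_nat_power[symmetric] power_mult[symmetric] mult.commute)
qed

subsection \<open>Integrality at \<open>p\<close>\<close>

lemma p_integers_of_int: "prime p \<Longrightarrow> of_int a \<in> p_integers p"
  unfolding p_integers_def mem_Collect_eq
  by (intro exI[of _ a] exI[of _ 1]) (simp add: prime_nat_iff)

lemma p_integers_of_nat: "prime p \<Longrightarrow> of_nat a \<in> p_integers p"
  using p_integers_of_int[of p "int a"] by simp

lemma p_integers_minus_one_power: "prime p \<Longrightarrow> (- 1) ^ j \<in> p_integers p"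
  using p_integers_of_int[of p "(- 1) ^ j"] by simp

lemma p_integers_divide_of_nat:
  assumes "prime p" "x \<in> p_integers p" "\<not> p dvd b"
  shows "x / of_nat b \<in> p_integers p"
proof -
  obtain c d where "x = of_int c / of_int d" "\<not> int p dvd d"
    using assms(2) unfolding p_integers_def by blast
  then have "x / of_nat b = of_int c / of_int (d * int b)" "\<not> int p dvd d * int b"
    using assms(1,3) by (simp_all add: prime_dvd_mult_iff)
  then show ?thesis unfolding p_integers_def by blast
qed

lemma p_integers_mult:
  assumes "prime p" "x \<in> p_integers p" "y \<in> p_integers p"
  shows "x * y \<in> p_integers p"
proof -
  obtain a b c d where "x = of_int a / of_int b" "y = of_int c / of_int d"
      "\<not> int p dvd b" "\<not> int p dvd d"
    using assms(2,3) unfolding p_integers_def by blast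
  then have "x * y = of_int (a * c) / of_int (b * d)" "\<not> int p dvd b * d"
    using assms(1) by (simp_all add: prime_dvd_mult_iff)
  then show ?thesis unfolding p_integers_def by blast
qed

lemma p_integers_add:
  assumes "prime p" "x \<in> p_integers p" "y \<in> p_integers p"
  shows "x + y \<in> p_integers p"
proof -
  obtain a b c d where eq: "x = of_int a / of_int b" "y = of_int c / of_int d"
    and not_dvd: "\<not> int p dvd b" "\<not> int p dvd d"
    using assms(2,3) unfolding p_integers_def by blast
  from not_dvd have "b \<noteq> 0" "d \<noteq> 0" by auto
  then have "x + y = of_int (a * d + c * b) / of_int (b * d)" using eq by (simp add: field_simps)
  moreover have "\<not> int p dvd b * d" using not_dvd assms(1) by (simp add: prime_dvd_mult_iff)
  ultimately show ?thesis unfolding p_integers_def by blast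
qed

lemma p_integers_sum:
  assumes "prime p" "\<And>i. i \<in> A \<Longrightarrow> f i \<in> p_integers p"
  shows "sum f A \<in> p_integers p"
  using assms(2)
proof (induction A rule: infinite_finite_induct)
  case (insert x A)
  then show ?case using p_integers_add[OF assms(1)] by simp
qed (use p_integers_of_int[OF assms(1), of 0] in simp_all)

lemma p_dvd_1_iff: "p_dvd p 1 x \<longleftrightarrow> x \<in> p_integers p"
  by (simp add: p_dvd_def)

lemma p_dvd_divide_of_nat:
  assumes "prime p" "p_dvd p d x" "\<not> p dvd b"
  shows "p_dvd p d (x / of_nat b)"
proof -
  obtain y where "y \<in> p_integers p" "x = d * y"
    using assms(2) unfolding p_dvd_def by blast
  then show ?thesis
    using p_integers_divide_of_nat[OF assms(1) _ assms(3)] unfolding p_dvd_def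
    by (intro bexI[of _ "y / of_nat b"]) simp_all
qed

lemma p_integers_mod_binom:
  assumes "prime p"
  shows "mod_binom p A B \<in> p_integers p"
  using p_integers_divide_of_nat[OF assms p_integers_of_nat[OF assms],
      of "mod_fact p B * mod_fact p (A - B)"] assms
  by (simp add: mod_binom_def prime_dvd_mult_iff not_dvd_mod_fact)

subsection \<open>The alternating sum\<close>

definition ballot_number :: "nat \<Rightarrow> nat \<Rightarrow> rat" where
  "ballot_number n j = of_nat ((2 * n + 1) choose j) * of_nat (2 * (n - j) + 1) / of_nat (2 * n + 1)"

definition ballot_sum :: "nat \<Rightarrow> nat \<Rightarrow> nat \<Rightarrow> rat" where
  "ballot_sum p n m = (\<Sum>j = 0..n. (- 1) ^ j * ballot_number n j * mod_binom p ((n + 1 - j) * m) m)"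

lemma p_integers_ballot_sum:
  assumes "prime p" "\<not> p dvd 2 * n + 1"
  shows "ballot_sum p n m \<in> p_integers p"
proof -
  have "of_nat (((2 * n + 1) choose j) * (2 * (n - j) + 1)) / of_nat (2 * n + 1) \<in> p_integers p" for j
    by (intro p_integers_divide_of_nat p_integers_of_nat assms)
  then have "ballot_number n j \<in> p_integers p" for j
    unfolding ballot_number_def of_nat_mult .
  then show ?thesis
    unfolding ballot_sum_def
    by (intro p_integers_sum p_integers_mult p_integers_minus_one_power p_integers_mod_binom assms)
qed

lemma ballot_sum_eq_backward_difference:
  assumes "p dvd m" "odd p"
  shows "ballot_sum p n m =
    of_int (backward_difference (2 * n + 1) (poly (skew_nonmultiples_poly p m)) (int n)) /
    of_nat (2 * ((2 * n + 1) * mod_fact p m))"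
proof -
  let ?W = "skew_nonmultiples_poly p m"
  have summand: "(- 1) ^ j * ballot_number n j * mod_binom p ((n + 1 - j) * m) m =
      of_int ((- 1) ^ j * int ((2 * n + 1) choose j) * poly ?W (int n - int j)) /
      of_nat ((2 * n + 1) * mod_fact p m)" if "j \<le> n" for j
  proof -
    have binom: "mod_binom p ((n + 1 - j) * m) m =
        of_int (poly (nonmultiples_poly p m) ((int n - int j) * int m)) / of_nat (mod_fact p m)"
      using mod_binom_eq_poly_nonmultiples_poly[OF assms(1), of "n - j"] that
      by (simp add: of_nat_diff Suc_diff_le)
    have weight: "of_nat (2 * (n - j) + 1) = (of_int (2 * (int n - int j) + 1) :: rat)"
      using that by (simp add: of_nat_diff)
    show ?thesis
      unfolding ballot_number_def poly_skew_nonmultiples_poly binom weight of_int_mult of_int_power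
        of_int_minus of_int_1 of_int_of_nat_eq of_nat_mult by simp
  qed
  have "ballot_sum p n m =
      of_int (\<Sum>j\<le>n. (- 1) ^ j * int ((2 * n + 1) choose j) * poly ?W (int n - int j)) /
      of_nat ((2 * n + 1) * mod_fact p m)"
    unfolding ballot_sum_def atLeast0AtMost of_int_sum sum_divide_distrib
    by (intro sum.cong refl summand) simp
  also have "\<dots> = of_int (backward_difference (2 * n + 1) (poly ?W) (int n)) /
      of_nat (2 * ((2 * n + 1) * mod_fact p m))"
    by (simp only: backward_difference_skew poly_skew_nonmultiples_poly_reflect[OF assms] of_int_mult
        of_nat_mult of_int_numeral of_nat_numeral mult_divide_mult_cancel_left_if
        zero_neq_numeral[symmetric] if_False)
  finally show ?thesis .
qed

lemma prime_power_p_dvd_ballot_sum: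
  assumes "prime p" "p dvd m" "m > 0" "n > 0" "2 * n + 1 < p"
  shows "p_dvd p (of_nat (p ^ ((2 * n + 1) * multiplicity p m))) (ballot_sum p n m)"
proof -
  have "\<not> p dvd 2" "\<not> p dvd 2 * n + 1"
    using assms(4,5) by (auto dest: dvd_imp_le)
  then have "\<not> p dvd 2 * ((2 * n + 1) * mod_fact p m)"
    using not_dvd_mod_fact assms(1) by (simp only: prime_dvd_mult_iff simp_thms)
  moreover have "int (p ^ ((2 * n + 1) * multiplicity p m)) dvd
      backward_difference (2 * n + 1) (poly (skew_nonmultiples_poly p m)) (int n)"
    using prime_power_dvd_backward_difference_skew_nonmultiples_poly[of p m "2 * n"] assms by simp
  moreover have "odd p" using assms prime_odd_nat[of p] by simp
  ultimately show ?thesis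
    unfolding ballot_sum_eq_backward_difference[OF assms(2) \<open>odd p\<close>]
    using assms(1) by (intro p_dvd_divide_of_nat p_dvd_of_int_iff[THEN iffD2])
qed

theorem theorem1:
  fixes n m p :: nat
  assumes "n \<ge> 1" and "m \<ge> 1" and "prime p" and "p > 2 * n + 1"
  shows "p_dvd p (of_nat (p ^ ((2 * n + 1) * multiplicity p m)))
    (\<Sum>j = 0..n. (- 1) ^ j * (of_nat ((2 * n + 1) choose j) * of_nat (2 * (n - j) + 1) / of_nat (2 * n + 1))
        * mod_binom p ((n + 1 - j) * m) m)"
proof -
  have "p_dvd p (of_nat (p ^ ((2 * n + 1) * multiplicity p m))) (ballot_sum p n m)"
  proof (cases "p dvd m")
    case True
    then show ?thesis using prime_power_p_dvd_ballot_sum assms by simp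
  next
    case False
    have "\<not> p dvd 2 * n + 1" using assms(4) by (auto dest: dvd_imp_le)
    then have "ballot_sum p n m \<in> p_integers p" using p_integers_ballot_sum assms(3) by simp
    then show ?thesis using False by (simp add: not_dvd_imp_multiplicity_0 p_dvd_1_iff)
  qed
  then show ?thesis by (simp only: ballot_sum_def ballot_number_def)
qed

end
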